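(* Let $q$ be a complex number with $|q|<1$. Then the following four identities hold: \begin{align*} \sum_{i,j,k\ge 0}\frac{q^{\frac{1}{2}i^2+\frac{3}{2}j^2+\frac{3}{2}k^2+ij+jk+\frac{1}{2}i-\frac{1}{2}j+\frac{1}{2}k}}{(q;q)_i(q;q)_j(q^2;q^2)_k} &=\frac{(-q;q)_\infty}{(q,q^4;q^5)_\infty},\\ \sum_{i,j,k\ge 0}\frac{q^{\frac{1}{2}i^2+\frac{3}{2}j^2+\frac{3}{2}k^2+ij+jk+\frac{1}{2}i+\frac{1}{2}j-\frac{1}{2}k}}{(q;q)_i(q;q)_j(q^2;q^2)_k} &=\frac{(-q;q)_\infty}{(q,q^4;q^5)_\infty},\\ \sum_{i,j,k\ge 0}\frac{q^{\frac{1}{2}i^2+\frac{3}{2}j^2+\frac{3}{2}k^2+ij+jk+\frac{1}{2}i+\frac{1}{2}j+\frac{3}{2}k}}{(q;q)_i(q;q)_j(q^2;q^2)_k} &=\frac{(-q;q)_\infty}{(q^2,q^3;q^5)_\infty},\\ \sum_{i,j,k\ge 0}\frac{q^{\frac{1}{2}i^2+\frac{3}{2}j^2+\frac{3}{2}k^2+ij+jk+\frac{1}{2}i+\frac{3}{2}j+\frac{1}{2}k}}{(q;q)_i(q;q)_j(q^2;q^2)_k} &=\frac{(-q;q)_\infty}{(q^2,q^3;q^5)_\infty}. \end{align*}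
   Context: For $|q|<1$: $(a;q)_\infty=\prod_{m=0}^\infty(1-aq^m)$, $(a;q)_n=(a;q)_\infty/(aq^n;q)_\infty=\prod_{m=0}^{n-1}(1-aq^m)$ for integers $n\ge0$, and $(a_1,\dots,a_r;q)_\infty=(a_1;q)_\infty\cdots(a_r;q)_\infty$; the same notation is used with the base $q$ replaced by a power of $q$. All exponents of $q$ in the sums are integers. *)

theory Defs
  imports "HOL-Analysis.Analysis"
begin

definition qpoch :: "complex \<Rightarrow> complex \<Rightarrow> nat \<Rightarrow> complex" where
  "qpoch a q n = (\<Prod>m<n. 1 - a * q ^ m)"

definition qpoch_inf :: "complex \<Rightarrow> complex \<Rightarrow> complex" where
  "qpoch_inf a q = (\<Prod>m. 1 - a * q ^ m)"

text \<open>
  Exponents such as \<open>i\<^sup>2/2 + 3j\<^sup>2/2 + 3k\<^sup>2/2 + ij + jk + i/2 - j/2 + k/2\<close> are written over the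
  integers as (numerator) \<open>div 2\<close>. The numerators have the shape below with \<open>a\<close>, \<open>b\<close>, \<open>c\<close> odd, so
  this division is exact, and with \<open>a, b, c \<ge> -1\<close>, so the exponents are nonnegative and \<open>powi\<close>
  is an ordinary power, also at \<open>q = 0\<close>.
\<close>

lemma even_exponent_numerator:
  fixes i j k a b c :: int
  assumes "odd a" "odd b" "odd c"
  shows "even (i^2 + 3*j^2 + 3*k^2 + 2*i*j + 2*j*k + a*i + b*j + c*k)"
  using assms by auto

lemma exponent_numerator_nonneg:
  fixes i j k :: nat and a b c :: int
  assumes "a \<ge> -1" "b \<ge> -1" "c \<ge> -1"
  shows "int i^2 + 3 * int j^2 + 3 * int k^2 + 2 * int i * int j + 2 * int j * int k
           + a * int i + b * int j + c * int k \<ge> 0"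
proof -
  have sq: "int n \<le> int n ^ 2" for n
    by (cases n) (auto simp: power2_eq_square)
  have lin: "- int n \<le> x * int n" if "x \<ge> -1" for x n
    using mult_right_mono[OF that, of "int n"] by simp
  have "0 \<le> int i * int j" "0 \<le> int j * int k" by simp_all
  with sq[of i] sq[of j] sq[of k] lin[OF assms(1), of i] lin[OF assms(2), of j] lin[OF assms(3), of k]
  show ?thesis unfolding mult.assoc by linarith
qed

end

theory Submission
  imports Defs
begin

text \<open>
  The triple sums collapse to the two Rogers--Ramanujan sums. Only the factor
  \<open>q\<^bsup>i(i-1)/2\<^esup> (q\<^bsup>j+1\<^esup>)\<^bsup>i\<^esup> / (q;q)\<^sub>i\<close> of the summand involves \<open>i\<close>, and by Euler's identity
  (\<open>euler_sum\<close>) its sum is \<open>(-q\<^bsup>j+1\<^esup>;q)\<^sub>\<infinity> = (-q;q)\<^sub>\<infinity> / (-q;q)\<^sub>j\<close>. Since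
  \<open>(q;q)\<^sub>j (-q;q)\<^sub>j = (q\<^sup>2;q\<^sup>2)\<^sub>j\<close>, what remains is \<open>(-q;q)\<^sub>\<infinity>\<close> times a double sum whose denominator
  \<open>(q\<^sup>2;q\<^sup>2)\<^sub>j (q\<^sup>2;q\<^sup>2)\<^sub>k\<close> is symmetric in \<open>j\<close> and \<open>k\<close> (\<open>triple_to_double_sum\<close>). Exchanging \<open>j\<close> and \<open>k\<close>
  therefore turns the second identity into the first and the fourth into the third.

  On the antidiagonal \<open>j + k = n\<close> the remaining exponent is \<open>n\<^sup>2 + d n + (j-k)(j-k-1)/2\<close>, with \<open>d = 0\<close> in the
  first identity and \<open>d = 1\<close> in the third. The sum of \<open>q\<^bsup>(j-k)(j-k-1)/2\<^esup> / ((q\<^sup>2;q\<^sup>2)\<^sub>j (q\<^sup>2;q\<^sup>2)\<^sub>k)\<close>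
  over the antidiagonal is \<open>1 / (q;q)\<^sub>n\<close> (\<open>antidiagonal_sum\<close>), so the double sum is
  \<open>\<Sum>\<^sub>n q\<^bsup>n\<^sup>2 + d n\<^esup> / (q;q)\<^sub>n\<close>, which the Rogers--Ramanujan identities evaluate.

  These are proved by a Bailey chain. The finite Jacobi triple product (\<open>finite_triple_product\<close>) at \<open>z = -1\<close>
  says that the weights \<open>(-1)\<^bsup>r\<^esup> q\<^bsup>r(r-1)/2\<^esup>\<close> against the kernel \<open>1 / ((q;q)\<^bsub>n-r\<^esub> (q;q)\<^bsub>n+r+d\<^esub>)\<close> sum to \<open>1\<close>
  for \<open>n = 0\<close> and to \<open>0\<close> otherwise. A limiting case of the q-Vandermonde summation (\<open>q_vandermonde\<close>)
  multiplies the weights by \<open>q\<^bsup>r(r+d)\<^esup>\<close> at the price of one more sum over \<open>n\<close> (\<open>bailey_iterate\<close>). Two such steps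
  give a finite form of the identities, whose limit equates the Rogers--Ramanujan sum with a theta series of
  base \<open>q\<^sup>5\<close>, and the infinite triple product factors this series.

  The product formula, the Vandermonde sum and the antidiagonal sum are proved in the same way. With \<open>1 / (q;q)\<^sub>n\<close> extended by \<open>0\<close> to negative \<open>n\<close>,
  both sides satisfy the same recurrence in a length parameter: the factor \<open>1 - q\<^bsup>m+n\<^esup>\<close> splits as
  \<open>(1 - q\<^bsup>m\<^esup>) + q\<^bsup>m\<^esup> (1 - q\<^bsup>n\<^esup>)\<close>, and either part lowers one of the reciprocal factorials. These sums
  run over \<open>int\<close>, so that shifting the index produces no boundary terms.
\<close>

section \<open>Reciprocal q-factorials and triangular exponents\<close>

text \<open>
  \<open>1 / (q;q)\<^sub>n\<close>, with the value \<open>0\<close> at negative \<open>n\<close> that \<open>(a;q)\<^sub>n = (a;q)\<^sub>\<infinity> / (aq\<^sup>n;q)\<^sub>\<infinity>\<close> suggests. With it,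
  finite q-binomial sums become bilateral sums whose terms vanish outside a finite range.
\<close>
definition qfac_recip :: "complex \<Rightarrow> int \<Rightarrow> complex" where
  "qfac_recip q n = (if n < 0 then 0 else 1 / qpoch q q (nat n))"

definition tri :: "int \<Rightarrow> int" where
  "tri r = r * (r - 1) div 2"

lemma two_tri: "2 * tri r = r * (r - 1)"
  unfolding tri_def by (cases "even r") auto

lemma tri_shifts:
  "tri (r + 1) = tri r + r" "tri (r - 1) = tri r - r + 1" "tri (1 - r) = tri r"
  using two_tri[of r] two_tri[of "r+1"] two_tri[of "r-1"] two_tri[of "1-r"]
  by (simp_all add: algebra_simps)

lemma tri_0 [simp]: "tri 0 = 0"
  by (simp add: tri_def)

lemma one_minus_power_nonzero:
  fixes q :: complex
  assumes "norm q < 1" "n > 0"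
  shows "1 - q ^ n \<noteq> 0"
proof
  assume "1 - q ^ n = 0"
  hence "norm (q ^ n) = 1" by simp
  moreover have "norm q ^ n < 1" using assms by (simp add: power_less_one_iff)
  ultimately show False by (simp add: norm_power)
qed

lemma one_minus_powi_nonzero:
  fixes q :: complex
  assumes "norm q < 1" "n > 0"
  shows "1 - q powi n \<noteq> 0"
  using one_minus_power_nonzero[of q "nat n"] assms by (simp add: power_int_def)

lemma qpoch_0 [simp]: "qpoch a q 0 = 1"
  by (simp add: qpoch_def)

lemma qpoch_Suc: "qpoch a q (Suc n) = qpoch a q n * (1 - a * q ^ n)"
  by (simp add: qpoch_def)

lemma qpoch_self_nonzero:
  assumes "norm q < 1"
  shows "qpoch q q n \<noteq> 0"
  using one_minus_power_nonzero[OF assms, of "Suc _"] by (auto simp: qpoch_def)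

lemma qfac_recip_neg [simp]: "n < 0 \<Longrightarrow> qfac_recip q n = 0"
  by (simp add: qfac_recip_def)

lemma qfac_recip_0 [simp]: "qfac_recip q 0 = 1"
  by (simp add: qfac_recip_def qpoch_def)

lemma qfac_recip_of_nat [simp]: "qfac_recip q (int n) = 1 / qpoch q q n"
  by (simp add: qfac_recip_def)

text \<open>
  The recurrence holds at \<open>n = 0\<close> and for negative \<open>n\<close> as well, which is what makes the extension by zero useful.
\<close>
lemma qfac_recip_step:
  assumes "norm q < 1"
  shows "(1 - q powi n) * qfac_recip q n = qfac_recip q (n - 1)"
proof -
  consider "n < 0" | "n = 0" | m where "n = int (Suc m)"
    by (metis not_less_iff_gr_or_eq gr0_implies_Suc zero_less_imp_eq_int)
  thus ?thesis
  proof cases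
    case (3 m)
    have "1 - q ^ Suc m \<noteq> 0" by (rule one_minus_power_nonzero) (use assms in auto)
    thus ?thesis using qpoch_self_nonzero[OF assms, of m]
      by (simp add: 3 qpoch_Suc divide_simps del: of_nat_Suc) (simp add: qfac_recip_def nat_add_distrib)
  qed auto
qed

lemma qfac_recip_step':
  assumes "norm q < 1"
  shows "(1 - q powi (n + 1)) * qfac_recip q (n + 1) = qfac_recip q n"
  using qfac_recip_step[OF assms, of "n + 1"] by simp

lemma has_sum_shift_int:
  fixes f :: "int \<Rightarrow> 'a :: {comm_monoid_add, topological_space}"
  assumes "(f has_sum S) UNIV"
  shows "((\<lambda>r. f (r + c)) has_sum S) UNIV"
  using has_sum_reindex_bij_witness[of UNIV "\<lambda>r. r - c" "\<lambda>r. r + c" UNIV f "\<lambda>r. f (r + c)" S S] assms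
  by auto

lemma has_sum_reflect_int:
  fixes f :: "int \<Rightarrow> 'a :: {comm_monoid_add, topological_space}"
  assumes "(f has_sum S) UNIV"
  shows "((\<lambda>r. f (c - r)) has_sum S) UNIV"
  using has_sum_reindex_bij_witness[of UNIV "\<lambda>r. c - r" "\<lambda>r. c - r" UNIV f "\<lambda>r. f (c - r)" S S] assms
  by auto

lemma has_sum_at_zero:
  fixes f :: "int \<Rightarrow> complex"
  assumes "\<And>r. r \<noteq> 0 \<Longrightarrow> f r = 0" "S = f 0"
  shows "(f has_sum S) UNIV"
  by (rule has_sum_finite_neutralI[of "{0}"]) (use assms in auto)

text \<open>
  The shape of the induction steps for the finite summation formulas: a recurrence expresses a nonzero multiple \<open>c * f\<close> of the wanted
  summand by summands whose sums are known.
\<close>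
lemma has_sum_from_multiple:
  fixes f g :: "'b \<Rightarrow> complex"
  assumes "(g has_sum S) A" "c \<noteq> 0" "\<And>r. c * f r = g r" "c * T = S"
  shows "(f has_sum T) A"
proof -
  have "((\<lambda>r. inverse c * g r) has_sum (inverse c * S)) A"
    by (rule has_sum_cmult_right[OF assms(1)])
  moreover have "inverse c * g r = f r" for r
    using assms(2) assms(3)[of r, symmetric] by simp
  moreover have "inverse c * S = T" using assms(2) assms(4)[symmetric] by simp
  ultimately show ?thesis by simp
qed

section \<open>Finite summation formulas\<close>

text \<open>
  A finite Jacobi triple product with independent numbers \<open>M\<close> and \<open>N\<close> of factors of the two kinds. Increasing
  either number multiplies the right-hand side by one linear factor over \<open>1 - q\<^bsup>M+N+1\<^esup>\<close>, and splitting
  \<open>1 - q\<^bsup>M+N+1\<^esup>\<close> gives the same for the sum: one part reproduces the old summand and the other a shifted copy of it. The case \<open>N = 0\<close> is the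
  q-binomial theorem, \<open>M = N\<close> leads to Jacobi's identity, and \<open>z = -1\<close> starts the Bailey chain.
\<close>
lemma finite_triple_product:
  assumes q: "norm q < 1" "q \<noteq> 0" and z: "z \<noteq> 0"
  shows "((\<lambda>r. q powi tri r * z powi r * qfac_recip q (int N + r) * qfac_recip q (int M - r))
           has_sum (qfac_recip q (int (M + N)) * qpoch (- z) q M * qpoch (- q / z) q N)) UNIV"
proof -
  define f where "f M N r = q powi tri r * z powi r * qfac_recip q (int N + r) * qfac_recip q (int M - r)" for M N :: nat and r
  define v where "v M N = qfac_recip q (int (M + N)) * qpoch (- z) q M * qpoch (- q / z) q N" for M N
  have base: "(f 0 0 has_sum v 0 0) UNIV"
    by (rule has_sum_at_zero) (auto simp: f_def v_def qpoch_def qfac_recip_def)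
  have stepM: "(f (Suc M) N has_sum v (Suc M) N) UNIV" if "(f M N has_sum v M N) UNIV" for M N
  proof (rule has_sum_from_multiple[where c = "1 - q powi (int M + int N + 1)"])
    show "((\<lambda>r. f M N r + z * q ^ M * f M N (r + (-1))) has_sum (v M N + z * q ^ M * v M N)) UNIV"
      by (intro has_sum_add has_sum_cmult_right has_sum_shift_int that)
    show "1 - q powi (int M + int N + 1) \<noteq> 0"
      by (rule one_minus_powi_nonzero) (use q in auto)
    show "(1 - q powi (int M + int N + 1)) * f (Suc M) N r = f M N r + z * q ^ M * f M N (r + (-1))" for r
    proof -
      define P where "P = q powi (int M + 1 - r)"
      define A where "A = q powi (int N + r)"
      have PA: "q powi (int M + int N + 1) = P * A"
        unfolding P_def A_def using q by (simp add: algebra_simps flip: power_int_add)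
      have 1: "(1 - P) * qfac_recip q (int (Suc M) - r) = qfac_recip q (int M - r)"
        using qfac_recip_step'[OF q(1), of "int M - r"] by (simp add: P_def algebra_simps)
      have 2: "(1 - A) * qfac_recip q (int N + r) = qfac_recip q (int N + r - 1)"
        using qfac_recip_step[OF q(1), of "int N + r"] by (simp add: A_def)
      have 3: "P * (q powi tri r * z powi r) = z * q ^ M * (q powi tri (r - 1) * z powi (r - 1))"
      proof -
        have "P * q powi tri r = q ^ M * q powi tri (r - 1)"
          unfolding P_def using q by (simp add: tri_shifts algebra_simps flip: power_int_add power_int_of_nat)
        moreover have "z powi r = z * z powi (r - 1)"
          using power_int_add_1[of z "r - 1"] z by simp
        ultimately show ?thesis by simp
      qed
      have "(1 - P * A) * (X * R1 * R2) = X * R1 * ((1 - P) * R2) + (P * X) * ((1 - A) * R1) * R2" for X R1 R2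
        by (simp add: algebra_simps)
      \<comment> \<open>the first part lowers the factor with \<open>M\<close>, the second one the factor with \<open>N\<close>\<close>
      from this[of "q powi tri r * z powi r" "qfac_recip q (int N + r)" "qfac_recip q (int (Suc M) - r)"]
      show ?thesis unfolding 1 2 PA f_def 3 by (simp add: algebra_simps)
    qed
    have "K = c * K' \<Longrightarrow> c * (K' * (P * (1 - - z * x)) * Q) = K * P * Q + z * x * (K * P * Q)"
      for K c K' P Q x :: complex by (simp add: algebra_simps)
    from this[OF qfac_recip_step'[OF q(1), of "int (M + N)", symmetric]]
    show "(1 - q powi (int M + int N + 1)) * v (Suc M) N = v M N + z * q ^ M * v M N"
      by (simp add: v_def qpoch_Suc add_ac del: qfac_recip_of_nat)
  qed
  have stepN: "(f M (Suc N) has_sum v M (Suc N)) UNIV" if "(f M N has_sum v M N) UNIV" for M N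
  proof (rule has_sum_from_multiple[where c = "1 - q powi (int M + int N + 1)"])
    show "((\<lambda>r. f M N r + q ^ Suc N / z * f M N (r + 1)) has_sum (v M N + q ^ Suc N / z * v M N)) UNIV"
      by (intro has_sum_add has_sum_cmult_right has_sum_shift_int that)
    show "1 - q powi (int M + int N + 1) \<noteq> 0"
      by (rule one_minus_powi_nonzero) (use q in auto)
    show "(1 - q powi (int M + int N + 1)) * f M (Suc N) r = f M N r + q ^ Suc N / z * f M N (r + 1)" for r
    proof -
      define P where "P = q powi (int N + 1 + r)"
      define A where "A = q powi (int M - r)"
      have PA: "q powi (int M + int N + 1) = P * A"
        unfolding P_def A_def using q by (simp add: algebra_simps flip: power_int_add)
      have 1: "(1 - P) * qfac_recip q (int (Suc N) + r) = qfac_recip q (int N + r)"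
        using qfac_recip_step'[OF q(1), of "int N + r"] by (simp add: P_def algebra_simps)
      have 2: "(1 - A) * qfac_recip q (int M - r) = qfac_recip q (int M - r - 1)"
        using qfac_recip_step[OF q(1), of "int M - r"] by (simp add: A_def)
      have 3: "P * (q powi tri r * z powi r) = q ^ Suc N / z * (q powi tri (r + 1) * z powi (r + 1))"
      proof -
        have "int N + 1 + r + tri r = int (Suc N) + tri (r + 1)" by (simp add: tri_shifts)
        hence "P * q powi tri r = q ^ Suc N * q powi tri (r + 1)"
          unfolding P_def using q
          by (simp del: power_Suc of_nat_Suc flip: power_int_add power_int_of_nat)
        moreover have "z powi (r + 1) / z = z powi r"
          using power_int_add_1[of z r] z by simp
        ultimately show ?thesis by (metis (no_types, lifting) mult.assoc times_divide_eq_left times_divide_eq_right)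
      qed
      have "(1 - P * A) * (X * R1 * R2) = X * ((1 - P) * R1) * R2 + (P * X) * R1 * ((1 - A) * R2)" for X R1 R2
        by (simp add: algebra_simps)
      from this[of "q powi tri r * z powi r" "qfac_recip q (int (Suc N) + r)" "qfac_recip q (int M - r)"]
      show ?thesis unfolding 1 2 PA f_def 3 by (simp add: algebra_simps)
    qed
    have "K = c * K' \<Longrightarrow> c * (K' * P * (Q * (1 - - q / z * x))) = K * P * Q + q * x / z * (K * P * Q)"
      for K c K' P Q x :: complex by (simp add: algebra_simps)
    from this[OF qfac_recip_step'[OF q(1), of "int (M + N)", symmetric]]
    show "(1 - q powi (int M + int N + 1)) * v M (Suc N) = v M N + q ^ Suc N / z * v M N"
      by (simp add: v_def qpoch_Suc add_ac del: qfac_recip_of_nat)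
  qed
  have "(f M 0 has_sum v M 0) UNIV" for M
    by (induction M) (use base stepM in auto)
  hence "(f M N has_sum v M N) UNIV"
    by (induction N) (use stepN in auto)
  thus ?thesis unfolding f_def[abs_def] v_def .
qed

text \<open>
  A limiting case of the q-Vandermonde summation. The induction on \<open>N\<close> splits
  \<open>1 - q\<^bsup>N+1\<^esup>\<close> into \<open>(1 - q\<^bsup>N+1-s\<^esup>) + q\<^bsup>N+1-s\<^esup> (1 - q\<^bsup>s\<^esup>)\<close>. The second part shifts \<open>s\<close> and raises \<open>m\<close> by one, so
  \<open>m\<close> must be general; it ranges over all integers because negative values occur for negative
  indices of the Bailey chain.
\<close>
lemma q_vandermonde:
  assumes q: "norm q < 1" "q \<noteq> 0"
  shows "((\<lambda>s. q powi (s * (s + m)) * qfac_recip q s * qfac_recip q (s + m) * qfac_recip q (int N - s))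
           has_sum (qfac_recip q (int N) * qfac_recip q (int N + m))) UNIV"
proof (induction N arbitrary: m)
  case 0
  show ?case
    by (rule has_sum_at_zero) (auto simp: qfac_recip_def)
next
  case (Suc N)
  define f where "f N m s = q powi (s * (s + m)) * qfac_recip q s * qfac_recip q (s + m) * qfac_recip q (int N - s)" for N :: nat and m s
  note IH = Suc.IH[folded f_def]
  have "(f (Suc N) m has_sum (qfac_recip q (int (Suc N)) * qfac_recip q (int (Suc N) + m))) UNIV"
  proof (rule has_sum_from_multiple[where c = "1 - q powi (int N + 1)"])
    show "((\<lambda>s. f N m s + q powi (int N + 1 + m) * f N (m + 1) (s + (-1))) has_sum
            (qfac_recip q (int N) * qfac_recip q (int N + m) +
             q powi (int N + 1 + m) * (qfac_recip q (int N) * qfac_recip q (int N + (m + 1))))) UNIV"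
      by (intro has_sum_add has_sum_cmult_right has_sum_shift_int IH)
    show "1 - q powi (int N + 1) \<noteq> 0"
      by (rule one_minus_powi_nonzero) (use q in auto)
    show "(1 - q powi (int N + 1)) * f (Suc N) m s = f N m s + q powi (int N + 1 + m) * f N (m + 1) (s + (-1))" for s
    proof -
      define P where "P = q powi (int N + 1 - s)"
      define A where "A = q powi s"
      have PA: "q powi (int N + 1) = P * A"
        unfolding P_def A_def using q by (simp flip: power_int_add)
      have 1: "(1 - P) * qfac_recip q (int (Suc N) - s) = qfac_recip q (int N - s)"
        using qfac_recip_step'[OF q(1), of "int N - s"] by (simp add: P_def algebra_simps)
      have 2: "(1 - A) * qfac_recip q s = qfac_recip q (s - 1)"
        using qfac_recip_step[OF q(1), of s] by (simp add: A_def)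
      have 3: "P * q powi (s * (s + m)) = q powi (int N + 1 + m) * q powi ((s - 1) * (s - 1 + (m + 1)))"
        unfolding P_def using q by (simp add: algebra_simps flip: power_int_add)
      have "(1 - P * A) * (X * R1 * R * R2) = X * R1 * R * ((1 - P) * R2) + (P * X) * ((1 - A) * R1) * R * R2" for X R1 R2 R
        by (simp add: algebra_simps)
      from this[of "q powi (s * (s + m))" "qfac_recip q s" "qfac_recip q (s + m)" "qfac_recip q (int (Suc N) - s)"]
      show ?thesis unfolding 1 2 PA f_def 3 by (simp add: algebra_simps)
    qed
    have a: "qfac_recip q (int N) = (1 - q powi (int N + 1)) * qfac_recip q (int (Suc N))"
      using qfac_recip_step'[OF q(1), of "int N"] by (simp add: algebra_simps)
    have b: "qfac_recip q (int N + m) = (1 - q powi (int N + 1 + m)) * qfac_recip q (int (Suc N) + m)"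
      using qfac_recip_step'[OF q(1), of "int N + m"] by (simp add: algebra_simps)
    have c: "int N + (m + 1) = int (Suc N) + m" by simp
    show "(1 - q powi (int N + 1)) * (qfac_recip q (int (Suc N)) * qfac_recip q (int (Suc N) + m)) =
          qfac_recip q (int N) * qfac_recip q (int N + m) +
             q powi (int N + 1 + m) * (qfac_recip q (int N) * qfac_recip q (int N + (m + 1)))"
      unfolding a b c by (simp add: algebra_simps)
  qed
  thus ?case by (simp only: f_def[abs_def])
qed

lemma norm_power2_less_1: "norm (q ^ 2) < 1" if "norm q < 1" for q :: complex
  using that by (simp add: norm_power abs_square_less_1)

text \<open>
  A relative of the Rogers--Szego evaluation \<open>\<Sum>\<^sub>k q\<^bsup>k\<^esup> [n choose k]\<close> in base \<open>q\<^sup>2\<close>, which equals \<open>(-q;q)\<^sub>n\<close>. Splitting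
  \<open>1 - q\<^bsup>2(n+1)\<^esup>\<close> yields the summand for \<open>n\<close> reflected by \<open>j \<mapsto> n + 1 - j\<close> plus \<open>q\<^bsup>n+1\<^esup>\<close> times the same
  summand unreflected. Hence the sum acquires the factor \<open>(1 + q\<^bsup>n+1\<^esup>) / (1 - q\<^bsup>2(n+1)\<^esup>) = 1 / (1 - q\<^bsup>n+1\<^esup>)\<close>.
\<close>
lemma antidiagonal_sum_int:
  assumes q: "norm q < 1" "q \<noteq> 0"
  shows "((\<lambda>j. q powi tri (2 * j - int n) * qfac_recip (q ^ 2) j * qfac_recip (q ^ 2) (int n - j))
           has_sum (1 / qpoch q q n)) UNIV"
proof (induction n)
  case 0
  show ?case
    by (rule has_sum_at_zero) (auto simp: qfac_recip_def qpoch_def)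
next
  case (Suc n)
  define f where "f n j = q powi tri (2 * j - int n) * qfac_recip (q ^ 2) j * qfac_recip (q ^ 2) (int n - j)"
    for n :: nat and j
  have q2: "norm (q ^ 2) < 1" by (rule norm_power2_less_1[OF q(1)])
  have nz: "1 - (q ^ 2) powi (int n + 1) \<noteq> 0"
    by (rule one_minus_powi_nonzero) (use q2 in auto)
  have fac: "1 - (q ^ 2) powi (int n + 1) = (1 - q ^ Suc n) * (1 + q ^ Suc n)"
    using power_int_of_nat[of "q\<^sup>2" "Suc n"]
    by (simp add: algebra_simps power2_eq_square power_mult_distrib)
  have "(f (Suc n) has_sum (1 / qpoch q q (Suc n))) UNIV"
  proof (rule has_sum_from_multiple[OF _ nz])
    show "((\<lambda>j. f n ((int n + 1) - j) + q ^ Suc n * f n j) has_sum (1 / qpoch q q n + q ^ Suc n * (1 / qpoch q q n))) UNIV"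
      using Suc.IH by (intro has_sum_add has_sum_cmult_right has_sum_reflect_int) (simp_all add: f_def[abs_def])
    show "(1 - (q ^ 2) powi (int n + 1)) * f (Suc n) j = f n ((int n + 1) - j) + q ^ Suc n * f n j" for j
    proof -
      define A where "A = (q ^ 2) powi j"
      define P where "P = (q ^ 2) powi (int n + 1 - j)"
      have PA: "(q ^ 2) powi (int n + 1) = A * P"
        unfolding P_def A_def using q by (simp flip: power_int_add)
      have 1: "(1 - P) * qfac_recip (q ^ 2) (int (Suc n) - j) = qfac_recip (q ^ 2) (int n - j)"
        using qfac_recip_step'[OF q2, of "int n - j"] by (simp add: P_def algebra_simps)
      have 2: "(1 - A) * qfac_recip (q ^ 2) j = qfac_recip (q ^ 2) (j - 1)"
        using qfac_recip_step[OF q2, of j] by (simp add: A_def)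
      have 3: "A * q powi tri (2 * j - int (Suc n)) = q ^ Suc n * q powi tri (2 * j - int n)"
      proof -
        have "tri (2 * j - int (Suc n)) = tri (2 * j - int n) - (2 * j - int n) + 1"
          using tri_shifts(2)[of "2 * j - int n"] by (simp add: algebra_simps)
        hence e: "2 * j + tri (2 * j - int (Suc n)) = int (Suc n) + tri (2 * j - int n)" by simp
        have "A = q powi (2 * j)" by (simp add: A_def power_int_power)
        thus ?thesis using q by (simp add: e del: power_Suc of_nat_Suc flip: power_int_add power_int_of_nat)
      qed
      \<comment> \<open>the invariance \<open>tri (1 - r) = tri r\<close> is what makes the reflected summand appear\<close>
      have 4: "tri (2 * (int n + 1 - j) - int n) = tri (2 * j - int (Suc n))"
        using tri_shifts(3)[of "2 * j - int (Suc n)"] by (simp add: algebra_simps)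
      have "(1 - A * P) * (X * R1 * R2) = X * ((1 - A) * R1) * R2 + (A * X) * R1 * ((1 - P) * R2)" for X R1 R2
        by (simp add: algebra_simps)
      from this[of "q powi tri (2 * j - int (Suc n))" "qfac_recip (q ^ 2) j" "qfac_recip (q ^ 2) (int (Suc n) - j)"]
      show ?thesis unfolding 1 2 PA f_def 3 4 by (simp add: algebra_simps)
    qed
    have "1 - q ^ Suc n \<noteq> 0" by (rule one_minus_power_nonzero) (use q in auto)
    thus "(1 - (q ^ 2) powi (int n + 1)) * (1 / qpoch q q (Suc n)) = 1 / qpoch q q n + q ^ Suc n * (1 / qpoch q q n)"
      using qpoch_self_nonzero[OF q(1), of n] unfolding fac qpoch_Suc by (simp add: field_simps)
  qed
  thus ?case by (simp only: f_def[abs_def])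
qed

section \<open>Infinite products and passage to the limit\<close>

lemma convergent_prod_qpoch:
  fixes a q :: complex
  assumes "norm q < 1"
  shows "convergent_prod (\<lambda>m. 1 - a * q ^ m)"
proof -
  have "summable (\<lambda>m. norm a * norm q ^ m)"
    using assms by (intro summable_mult summable_geometric) auto
  hence "summable (\<lambda>m. norm ((1 - a * q ^ m) - 1))" by (simp add: norm_mult norm_power del: summable_cmult_iff)
  thus ?thesis
    by (rule abs_convergent_prod_imp_convergent_prod[OF summable_imp_abs_convergent_prod])
qed

lemma qpoch_tendsto:
  assumes "norm q < 1"
  shows "(\<lambda>n. qpoch a q n) \<longlonglongrightarrow> qpoch_inf a q"
proof -
  have "(\<lambda>n. qpoch a q (Suc n)) \<longlonglongrightarrow> qpoch_inf a q"
    using convergent_prod_LIMSEQ[OF convergent_prod_qpoch[OF assms, of a]]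
    by (simp add: qpoch_def qpoch_inf_def lessThan_Suc_atMost)
  thus ?thesis by (simp only: filterlim_sequentially_Suc)
qed

lemma qpoch_inf_nonzero:
  assumes "norm q < 1" "norm a < 1"
  shows "qpoch_inf a q \<noteq> 0"
proof -
  have "1 - a * q ^ m \<noteq> 0" for m
  proof
    assume "1 - a * q ^ m = 0"
    hence "norm (a * q ^ m) = 1" by simp
    moreover have "norm (a * q ^ m) \<le> norm a * 1"
      unfolding norm_mult norm_power using assms by (intro mult_left_mono power_le_one) auto
    ultimately show False using assms by simp
  qed
  thus ?thesis unfolding qpoch_inf_def
    by (intro prodinf_nonzero convergent_prod_qpoch assms)
qed

lemma qfac_recip_tendsto:
  assumes "norm q < 1"
  shows "(\<lambda>n. qfac_recip q (int n + r)) \<longlonglongrightarrow> 1 / qpoch_inf q q"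
proof -
  have "(\<lambda>n. 1 / qpoch q q n) \<longlonglongrightarrow> 1 / qpoch_inf q q"
    by (intro tendsto_intros qpoch_tendsto qpoch_inf_nonzero assms)
  moreover have "filterlim (\<lambda>n. nat (int n + r)) at_top sequentially"
    unfolding filterlim_at_top
  proof
    fix Z :: nat
    show "\<forall>\<^sub>F n in sequentially. Z \<le> nat (int n + r)"
      using eventually_ge_at_top[of "nat (int Z - r)"] by eventually_elim linarith
  qed
  ultimately have "(\<lambda>n. 1 / qpoch q q (nat (int n + r))) \<longlonglongrightarrow> 1 / qpoch_inf q q"
    by (rule filterlim_compose)
  moreover have "eventually (\<lambda>n. 1 / qpoch q q (nat (int n + r)) = qfac_recip q (int n + r)) sequentially"
    using eventually_ge_at_top[of "nat (- r)"] by eventually_elim (auto simp: qfac_recip_def)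
  ultimately show ?thesis by (rule Lim_transform_eventually)
qed

lemma qfac_recip_bounded:
  assumes "norm q < 1"
  obtains C where "C > 0" "\<And>n. norm (qfac_recip q n) \<le> C"
proof -
  have "Bseq (\<lambda>n. qfac_recip q (int n + 0))"
    by (rule convergent_imp_Bseq) (use qfac_recip_tendsto[OF assms, of 0] in \<open>auto simp: convergent_def\<close>)
  then obtain C where C: "C > 0" "\<And>n. norm (qfac_recip q (int n)) \<le> C"
    by (auto simp: Bseq_def)
  have "norm (qfac_recip q n) \<le> C" for n
    by (cases "n < 0") (use C in \<open>simp_all add: qfac_recip_def\<close>)
  thus ?thesis using that C by blast
qed

lemma theta_summable_nat:
  fixes q z :: complex
  assumes "norm q < 1"
  shows "summable (\<lambda>n. norm (q powi tri (int n) * z ^ n))"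
proof (cases "q = 0 \<or> z = 0")
  case True
  have "norm (q powi tri (int n) * z ^ n) = 0" if "n \<notin> {..<2}" for n
  proof -
    have "2 * tri (int n) \<noteq> 0" unfolding two_tri using that by auto
    thus ?thesis using True that by auto
  qed
  thus ?thesis by (intro summable_finite[of "{..<2}"]) auto
next
  case False
  have "(\<lambda>n. norm q ^ n * norm z) \<longlonglongrightarrow> 0 * norm z"
    by (intro tendsto_intros LIMSEQ_power_zero) (use assms in auto)
  hence "eventually (\<lambda>n. norm q ^ n * norm z < 1 / 2) sequentially"
    by (intro order_tendstoD) auto
  then obtain N where N: "\<And>n. n \<ge> N \<Longrightarrow> norm q ^ n * norm z < 1 / 2"
    by (auto simp: eventually_sequentially)
  show ?thesis
  proof (rule summable_ratio_test)
    show "1 / 2 < (1 :: real)" by simp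
    show "norm (norm (q powi tri (int (Suc n)) * z ^ Suc n)) \<le> 1 / 2 * norm (norm (q powi tri (int n) * z ^ n))"
      if "n \<ge> N" for n
    proof -
      have "tri (int (Suc n)) = tri (int n) + int n" using tri_shifts(1)[of "int n"] by (simp add: add.commute)
      hence "q powi tri (int (Suc n)) * z ^ Suc n = (q ^ n * z) * (q powi tri (int n) * z ^ n)"
        using False by (simp add: power_int_add)
      hence "norm (q powi tri (int (Suc n)) * z ^ Suc n) = norm ((q ^ n * z) * (q powi tri (int n) * z ^ n))"
        by (rule arg_cong)
      also have "\<dots> = (norm q ^ n * norm z) * norm (q powi tri (int n) * z ^ n)"
        by (simp add: norm_mult norm_power)
      also have "\<dots> \<le> 1 / 2 * norm (q powi tri (int n) * z ^ n)"
        using N[OF that] by (intro mult_right_mono) auto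
      finally show ?thesis by simp
    qed
  qed
qed

lemma summable_on_int_halves:
  fixes f :: "int \<Rightarrow> real"
  assumes "(\<lambda>n. f (int n)) summable_on UNIV" "(\<lambda>n. f (- int n)) summable_on UNIV"
  shows "f summable_on UNIV"
proof -
  have "f summable_on (range int)" "f summable_on (range (\<lambda>n. - int n))"
    using assms by (subst summable_on_reindex; simp add: inj_def o_def)+
  hence "f summable_on (range int \<union> range (\<lambda>n. - int n))"
    by (rule summable_on_union)
  moreover have "r \<in> range int \<union> range (\<lambda>n. - int n)" for r
    by (cases r rule: int_cases2) auto
  hence "range int \<union> range (\<lambda>n. - int n) = UNIV" by blast
  ultimately show ?thesis by simp
qed

text \<open>
  The negative half is again a series of the positive kind, with \<open>z\<close> replaced by \<open>q / z\<close>.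
\<close>
lemma theta_abs_summable:
  fixes q z :: complex
  assumes "norm q < 1" "q \<noteq> 0"
  shows "(\<lambda>r. norm (q powi tri r * z powi r)) summable_on UNIV"
proof (rule summable_on_int_halves)
  show "(\<lambda>n. norm (q powi tri (int n) * z powi int n)) summable_on UNIV"
    using theta_summable_nat[OF assms(1), of z] by (intro norm_summable_imp_summable_on) simp
  have "tri (- int n) = tri (int n) + int n" for n
    using two_tri[of "- int n"] two_tri[of "int n"] by (simp add: algebra_simps)
  hence "q powi tri (- int n) * z powi (- int n) = q powi tri (int n) * (q / z) ^ n" for n
    using assms(2) by (simp add: power_int_add power_int_minus power_divide field_simps)
  thus "(\<lambda>n. norm (q powi tri (- int n) * z powi (- int n))) summable_on UNIV"
    using theta_summable_nat[OF assms(1), of "q / z"] by (intro norm_summable_imp_summable_on) simp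
qed

lemma abs_summable_bounded_mult:
  fixes a g :: "'a \<Rightarrow> complex"
  assumes "(\<lambda>r. norm (a r)) summable_on A" "\<And>r. norm (g r) \<le> C"
  shows "(\<lambda>r. norm (a r * g r)) summable_on A"
proof (rule Infinite_Sum.abs_summable_on_comparison_test')
  show "(\<lambda>r. norm (a r) * C) summable_on A"
    by (rule summable_on_cmult_left[OF assms(1)])
  show "norm (a r * g r) \<le> norm (a r) * C" for r
    unfolding norm_mult using assms(2)[of r] by (intro mult_left_mono) auto
qed

text \<open>
  Tannery's theorem for bilateral sums whose terms are a fixed absolutely summable family times bounded factors
  with a common limit. In the applications the factors are reciprocal q-factorials whose index
  tends to infinity.
\<close>
lemma tannery_int:
  fixes a :: "int \<Rightarrow> complex" and g :: "nat \<Rightarrow> int \<Rightarrow> complex"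
  assumes a: "(\<lambda>r. norm (a r)) summable_on UNIV"
    and S: "\<And>n. ((\<lambda>r. a r * g n r) has_sum S n) UNIV"
    and C: "\<And>n r. norm (g n r) \<le> C"
    and lim: "\<And>r. (\<lambda>n. g n r) \<longlonglongrightarrow> c"
  shows "S \<longlonglongrightarrow> infsum a UNIV * c"
proof -
  define e where "e = int_decode"
  have bij: "bij e" by (simp add: e_def bij_int_decode)
  have "(\<lambda>k. norm (a (e k))) summable_on UNIV"
    using a summable_on_reindex_bij_betw[OF bij, of "\<lambda>r. norm (a r)"] by simp
  hence sum: "summable (\<lambda>k. norm (a (e k)))" by (rule summable_on_imp_summable)
  have "((\<lambda>n. \<Sum>k. a (e k) * g n (e k)) \<longlonglongrightarrow> (\<Sum>k. a (e k) * c))"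
  proof (rule tannerys_theorem[THEN conjunct2, THEN conjunct2])
    show "(\<lambda>n. a (e k) * g n (e k)) \<longlonglongrightarrow> a (e k) * c" for k
      by (intro tendsto_intros lim)
    show "\<forall>\<^sub>F (k, n) in at_top \<times>\<^sub>F sequentially. norm (a (e k) * g n (e k)) \<le> norm (a (e k)) * C"
      using C by (intro always_eventually) (auto simp: norm_mult intro!: mult_left_mono)
    show "summable (\<lambda>k. norm (a (e k)) * C)" by (intro summable_mult2 sum)
  qed auto
  moreover have "(\<Sum>k. a (e k) * g n (e k)) = S n" for n
    using S[of n] has_sum_reindex_bij_betw[OF bij, of "\<lambda>r. a r * g n r"]
    by (intro sums_unique[symmetric] has_sum_imp_sums) simp
  moreover have "(\<Sum>k. a (e k) * c) = infsum a UNIV * c"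
  proof -
    have "((\<lambda>r. a r * c) has_sum (infsum a UNIV * c)) UNIV"
      by (rule has_sum_cmult_left[OF has_sum_infsum[OF abs_summable_summable[OF a]]])
    thus ?thesis using has_sum_reindex_bij_betw[OF bij, of "\<lambda>r. a r * c"]
      by (intro sums_unique[symmetric] has_sum_imp_sums) simp
  qed
  ultimately show ?thesis by simp
qed

text \<open>
  The same limit used to evaluate \<open>a\<close> when the limit of the partial evaluations \<open>S\<close> is known independently.
\<close>
lemma has_sum_tannery_int:
  fixes a :: "int \<Rightarrow> complex" and g :: "nat \<Rightarrow> int \<Rightarrow> complex"
  assumes a: "(\<lambda>r. norm (a r)) summable_on UNIV"
    and S: "\<And>n. ((\<lambda>r. a r * g n r) has_sum S n) UNIV"
    and C: "\<And>n r. norm (g n r) \<le> C"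
    and lim: "\<And>r. (\<lambda>n. g n r) \<longlonglongrightarrow> c"
    and L: "S \<longlonglongrightarrow> L * c" and c: "c \<noteq> 0"
  shows "(a has_sum L) UNIV"
proof -
  have "infsum a UNIV * c = L * c"
    using LIMSEQ_unique[OF tannery_int[OF a S C lim] L] .
  hence "infsum a UNIV = L" using c by simp
  thus ?thesis using has_sum_infsum[OF abs_summable_summable[OF a]] by simp
qed

text \<open>
  The limit \<open>M = N \<longlonglongrightarrow> \<infinity>\<close> of the finite triple product: both reciprocal factorials in the summand
  tend to \<open>1 / (q;q)\<^sub>\<infinity>\<close>, while the prefactor \<open>1 / (q;q)\<^bsub>2N\<^esub>\<close> contributes this limit only once.
\<close>
lemma jacobi_triple_product:
  assumes q: "norm q < 1" "q \<noteq> 0" and z: "z \<noteq> 0"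
  shows "((\<lambda>r. q powi tri r * z powi r) has_sum
           (qpoch_inf q q * qpoch_inf (- z) q * qpoch_inf (- q / z) q)) UNIV"
proof -
  obtain C where C: "C > 0" "\<And>n. norm (qfac_recip q n) \<le> C"
    using qfac_recip_bounded[OF q(1)] by blast
  have nz: "qpoch_inf q q \<noteq> 0" by (rule qpoch_inf_nonzero) (use q in auto)
  show ?thesis
  proof (rule has_sum_tannery_int)
    show "(\<lambda>r. norm (q powi tri r * z powi r)) summable_on UNIV"
      by (rule theta_abs_summable[OF q])
    show "((\<lambda>r. q powi tri r * z powi r * (qfac_recip q (int n + r) * qfac_recip q (int n - r))) has_sum
          (qfac_recip q (int (n + n)) * qpoch (- z) q n * qpoch (- q / z) q n)) UNIV" for n
      using finite_triple_product[OF q z, of n n] by (simp add: mult.assoc)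
    show "norm (qfac_recip q (int n + r) * qfac_recip q (int n - r)) \<le> C * C" for n r
      unfolding norm_mult by (intro mult_mono C) (use C in auto)
    show "(\<lambda>n. qfac_recip q (int n + r) * qfac_recip q (int n - r)) \<longlonglongrightarrow> (1 / qpoch_inf q q) * (1 / qpoch_inf q q)" for r
      using tendsto_mult[OF qfac_recip_tendsto[OF q(1), of r] qfac_recip_tendsto[OF q(1), of "- r"]] by simp
    have "strict_mono (\<lambda>n. n + n :: nat)" by (auto simp: strict_mono_def)
    from LIMSEQ_subseq_LIMSEQ[OF qfac_recip_tendsto[OF q(1), of 0] this]
    have "(\<lambda>n. qfac_recip q (int (n + n))) \<longlonglongrightarrow> 1 / qpoch_inf q q" by (simp add: o_def del: of_nat_add)
    hence "(\<lambda>n. qfac_recip q (int (n + n)) * qpoch (- z) q n * qpoch (- q / z) q n) \<longlonglongrightarrow>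
             1 / qpoch_inf q q * qpoch_inf (- z) q * qpoch_inf (- q / z) q"
      by (intro tendsto_mult qpoch_tendsto q(1))
    also have "1 / qpoch_inf q q * qpoch_inf (- z) q * qpoch_inf (- q / z) q =
      qpoch_inf q q * qpoch_inf (- z) q * qpoch_inf (- q / z) q * ((1 / qpoch_inf q q) * (1 / qpoch_inf q q))"
      using nz by simp
    finally show "(\<lambda>n. qfac_recip q (int (n + n)) * qpoch (- z) q n * qpoch (- q / z) q n) \<longlonglongrightarrow>
      qpoch_inf q q * qpoch_inf (- z) q * qpoch_inf (- q / z) q * ((1 / qpoch_inf q q) * (1 / qpoch_inf q q))" .
    show "(1 / qpoch_inf q q) * (1 / qpoch_inf q q) \<noteq> 0" using nz by simp
  qed
qed

lemma has_sum_int_imp_nat: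
  fixes f :: "int \<Rightarrow> complex"
  assumes "(f has_sum S) UNIV" "\<And>r. r < 0 \<Longrightarrow> f r = 0"
  shows "((\<lambda>n. f (int n)) has_sum S) UNIV"
proof -
  have "(f has_sum S) (range int)"
  proof (rule has_sum_cong_neutral[THEN iffD1, rotated 3])
    show "f r = 0" if "r \<in> UNIV - range int" for r
      using that by (intro assms(2)) (metis DiffD2 nonneg_int_cases not_le rangeI)
  qed (use assms(1) in auto)
  thus ?thesis by (subst (asm) has_sum_reindex) (auto simp: o_def inj_def)
qed

text \<open>
  The limit \<open>M \<longlonglongrightarrow> \<infinity>\<close> of the finite triple product with \<open>N = 0\<close>, where the factor \<open>1 / (q;q)\<^bsub>r\<^esub>\<close>
  removes the negative half of the sum.
\<close>
lemma euler_sum: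
  assumes q: "norm q < 1" "q \<noteq> 0" and z: "z \<noteq> 0"
  shows "((\<lambda>n. q powi tri (int n) * z ^ n / qpoch q q n) has_sum qpoch_inf (- z) q) UNIV"
proof -
  obtain C where C: "C > 0" "\<And>n. norm (qfac_recip q n) \<le> C"
    using qfac_recip_bounded[OF q(1)] by blast
  have nz: "qpoch_inf q q \<noteq> 0" by (rule qpoch_inf_nonzero) (use q in auto)
  have "((\<lambda>r. q powi tri r * z powi r * qfac_recip q r) has_sum qpoch_inf (- z) q) UNIV"
  proof (rule has_sum_tannery_int)
    show "(\<lambda>r. norm (q powi tri r * z powi r * qfac_recip q r)) summable_on UNIV"
      by (intro abs_summable_bounded_mult[where C = C] theta_abs_summable[OF q] C)
    show "((\<lambda>r. q powi tri r * z powi r * qfac_recip q r * qfac_recip q (int n - r)) has_sum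
          (qfac_recip q (int n) * qpoch (- z) q n)) UNIV" for n
      using finite_triple_product[OF q z, of 0 n] by simp
    show "norm (qfac_recip q (int n - r)) \<le> C" for n r by (rule C)
    show "(\<lambda>n. qfac_recip q (int n - r)) \<longlonglongrightarrow> 1 / qpoch_inf q q" for r
      using qfac_recip_tendsto[OF q(1), of "- r"] by simp
    have "(\<lambda>n. qfac_recip q (int n) * qpoch (- z) q n) \<longlonglongrightarrow> 1 / qpoch_inf q q * qpoch_inf (- z) q"
      using qfac_recip_tendsto[OF q(1), of 0] by (intro tendsto_mult qpoch_tendsto q(1)) simp
    thus "(\<lambda>n. qfac_recip q (int n) * qpoch (- z) q n) \<longlonglongrightarrow> qpoch_inf (- z) q * (1 / qpoch_inf q q)"
      by (simp add: mult.commute)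
    show "1 / qpoch_inf q q \<noteq> 0" using nz by simp
  qed
  from has_sum_int_imp_nat[OF this] show ?thesis by simp
qed

section \<open>The Bailey chain and the Rogers--Ramanujan identities\<close>

text \<open>
  The q-Vandermonde sum with \<open>s = n - r\<close>, \<open>m = 2r + d\<close> and upper limit \<open>L - r\<close>; completing the square in the
  exponent produces the factor \<open>q\<^bsup>r(r+d)\<^esup>\<close>. For \<open>d \<le> 1\<close> the kernel vanishes at negative \<open>n\<close>, because \<open>n - r\<close>
  and \<open>n + r + d\<close> add up to \<open>2n + d < 0\<close> there.
\<close>
lemma bailey_step:
  assumes q: "norm q < 1" "q \<noteq> 0" and d: "d \<le> 1"
  shows "(\<Sum>n\<le>L. q ^ (n * n + d * n) * qfac_recip q (int L - int n) *
             (qfac_recip q (int n - r) * qfac_recip q (int n + r + int d))) =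
           q powi (r * (r + int d)) * (qfac_recip q (int L - r) * qfac_recip q (int L + r + int d))"
proof (cases "r \<le> int L")
  case False
  thus ?thesis by (auto intro!: sum.neutral)
next
  case True
  define N where "N = nat (int L - r)"
  have N: "int N = int L - r" using True by (simp add: N_def)
  define f where "f n = q powi (r * (r + int d)) * (q powi ((n - r) * (n - r + (2 * r + int d))) *
     qfac_recip q (n - r) * qfac_recip q (n - r + (2 * r + int d)) * qfac_recip q (int N - (n - r)))" for n
  have f_eq: "f n = q powi (n * n + int d * n) * qfac_recip q (int L - n) *
     (qfac_recip q (n - r) * qfac_recip q (n + r + int d))" for n
  proof -
    have "r * (r + int d) + (n - r) * (n - r + (2 * r + int d)) = n * n + int d * n" by (simp add: algebra_simps)
    hence pow: "q powi (r * (r + int d)) * q powi ((n - r) * (n - r + (2 * r + int d))) = q powi (n * n + int d * n)"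
      using q by (simp flip: power_int_add)
    have args: "n - r + (2 * r + int d) = n + r + int d" "int N - (n - r) = int L - n" by (simp_all add: N)
    have "x * (y * u * v * w) = (x * y) * w * (u * v)" for x y u v w :: complex by simp
    from this[of "q powi (r * (r + int d))"] show ?thesis unfolding f_def pow[symmetric] args .
  qed
  have f_nat: "f (int n) = q ^ (n * n + d * n) * qfac_recip q (int L - int n) *
     (qfac_recip q (int n - r) * qfac_recip q (int n + r + int d))" for n
    unfolding f_eq by (simp flip: power_int_of_nat)
  have "(f has_sum (q powi (r * (r + int d)) * (qfac_recip q (int N) * qfac_recip q (int N + (2 * r + int d))))) UNIV"
    using has_sum_shift_int[OF has_sum_cmult_right[OF q_vandermonde[OF q, of "2 * r + int d" N]], where c = "- r"]
    unfolding f_def by simp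
  hence "((\<lambda>n. f (int n)) has_sum (q powi (r * (r + int d)) * (qfac_recip q (int N) * qfac_recip q (int N + (2 * r + int d))))) UNIV"
  proof (rule has_sum_int_imp_nat)
    show "f n = 0" if "n < 0" for n
    proof -
      have "n - r < 0 \<or> n + r + int d < 0" using that d by linarith
      thus ?thesis unfolding f_eq by auto
    qed
  qed
  moreover have "((\<lambda>n. f (int n)) has_sum (\<Sum>n\<le>L. f (int n))) UNIV"
    by (rule has_sum_finite_neutralI) (auto simp: f_eq)
  ultimately have "(\<Sum>n\<le>L. f (int n)) = q powi (r * (r + int d)) * (qfac_recip q (int N) * qfac_recip q (int N + (2 * r + int d)))"
    by (rule has_sum_unique[symmetric])
  moreover have "int N + (2 * r + int d) = int L + r + int d" by (simp add: N)
  ultimately show ?thesis unfolding f_nat N by simp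
qed

lemma has_sum_finite_sum:
  fixes f :: "'a \<Rightarrow> 'b \<Rightarrow> complex"
  assumes "finite I" "\<And>i. i \<in> I \<Longrightarrow> (f i has_sum S i) A"
  shows "((\<lambda>x. \<Sum>i\<in>I. f i x) has_sum (\<Sum>i\<in>I. S i)) A"
  using assms by (induction I) (auto intro: has_sum_add)

lemma qpoch_one_eq_0: "n > 0 \<Longrightarrow> qpoch 1 q n = 0"
  by (auto simp: qpoch_def intro!: bexI[of _ 0])

text \<open>
  The finite triple product at \<open>z = -1\<close> with \<open>n\<close> and \<open>n + d\<close> factors: for \<open>n > 0\<close> the product \<open>(1;q)\<^sub>n\<close> contains
  a zero factor, and for \<open>n = 0\<close> the product \<open>(q;q)\<^sub>d\<close> cancels the prefactor \<open>1 / (q;q)\<^sub>d\<close>.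
\<close>
lemma bailey_unit:
  assumes q: "norm q < 1" "q \<noteq> 0"
  shows "((\<lambda>r. (-1) powi r * q powi tri r * (qfac_recip q (int n - r) * qfac_recip q (int n + r + int d)))
           has_sum (if n = 0 then 1 else 0)) UNIV"
proof -
  have "qfac_recip q (int (n + (n + d))) * qpoch 1 q n * qpoch q q (n + d) = (if n = 0 then 1 else 0)"
    using qpoch_self_nonzero[OF q(1), of d] by (simp add: qpoch_one_eq_0)
  thus ?thesis
    using finite_triple_product[OF q, of "-1" "n + d" n] by (simp add: mult_ac add_ac)
qed

text \<open>
  One step of the chain: applying the previous summation inside turns the evaluations \<open>B\<close> for the weights \<open>w\<close> into
  evaluations for the weights \<open>w r * q\<^bsup>r(r+d)\<^esup>\<close>.
\<close>
lemma bailey_iterate: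
  assumes q: "norm q < 1" "q \<noteq> 0" and d: "d \<le> 1"
    and B: "\<And>n. ((\<lambda>r. w r * (qfac_recip q (int n - r) * qfac_recip q (int n + r + int d))) has_sum B n) UNIV"
  shows "((\<lambda>r. w r * q powi (r * (r + int d)) * (qfac_recip q (int L - r) * qfac_recip q (int L + r + int d)))
            has_sum (\<Sum>n\<le>L. q ^ (n * n + d * n) * qfac_recip q (int L - int n) * B n)) UNIV"
proof -
  have "((\<lambda>r. \<Sum>n\<le>L. q ^ (n * n + d * n) * qfac_recip q (int L - int n) *
             (w r * (qfac_recip q (int n - r) * qfac_recip q (int n + r + int d)))) has_sum
           (\<Sum>n\<le>L. q ^ (n * n + d * n) * qfac_recip q (int L - int n) * B n)) UNIV"
    by (intro has_sum_finite_sum has_sum_cmult_right[OF B]) auto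
  moreover have "(\<Sum>n\<le>L. q ^ (n * n + d * n) * qfac_recip q (int L - int n) *
             (w r * (qfac_recip q (int n - r) * qfac_recip q (int n + r + int d)))) =
      w r * q powi (r * (r + int d)) * (qfac_recip q (int L - r) * qfac_recip q (int L + r + int d))" for r
    unfolding mult.assoc bailey_step[OF q d, of L r, symmetric, unfolded mult.assoc] sum_distrib_left
    by (simp add: mult_ac)
  ultimately show ?thesis by simp
qed

text \<open>
  Two steps of the chain from the unit weights. After the first one the evaluation is \<open>1 / (q;q)\<^sub>L\<close>, since only
  \<open>n = 0\<close> contributes. The accumulated exponent \<open>r(r-1)/2 + 2r(r+d)\<close> equals \<open>5 r(r-1)/2 + (2+2d) r\<close>, so
  the weights are those of a theta series in base \<open>q\<^sup>5\<close>.
\<close>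
lemma rogers_ramanujan_finite:
  assumes q: "norm q < 1" "q \<noteq> 0" and d: "d \<le> 1"
  shows "((\<lambda>r. (q ^ 5) powi tri r * (- (q ^ (2 + 2 * d))) powi r *
               (qfac_recip q (int L - r) * qfac_recip q (int L + r + int d)))
            has_sum (\<Sum>n\<le>L. q ^ (n * n + d * n) * qfac_recip q (int L - int n) * qfac_recip q (int n))) UNIV"
proof -
  have *: "(\<Sum>n\<le>L. q ^ (n * n + d * n) * qfac_recip q (int L - int n) * (if n = 0 then 1 else 0)) = qfac_recip q (int L)" for L
    by (subst sum.mono_neutral_right[of _ "{0}"]) auto
  note 1 = bailey_iterate[OF q d bailey_unit[OF q], unfolded *]
  note 2 = bailey_iterate[OF q d 1]
  have "(-1) powi r * q powi tri r * q powi (r * (r + int d)) * q powi (r * (r + int d)) =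
          (q ^ 5) powi tri r * (- (q ^ (2 + 2 * d))) powi r" for r
  proof -
    have add: "q powi (a + b) = q powi a * q powi b" for a b using q by (simp add: power_int_add)
    have e: "tri r + r * (r + int d) + r * (r + int d) = 5 * tri r + (2 + 2 * int d) * r"
      using two_tri[of r] by (simp add: algebra_simps)
    have "(- (q ^ (2 + 2 * d))) powi r = (-1) powi r * (q ^ (2 + 2 * d)) powi r"
      by (metis mult_minus1 power_int_mult_distrib)
    also have "(q ^ (2 + 2 * d)) powi r = q powi ((2 + 2 * int d) * r)"
      by (subst power_int_power) simp
    finally have "(q ^ 5) powi tri r * (- (q ^ (2 + 2 * d))) powi r =
        (-1) powi r * q powi (5 * tri r + (2 + 2 * int d) * r)"
      using q by (simp add: power_int_power power_int_add)
    also have "\<dots> = (-1) powi r * q powi tri r * q powi (r * (r + int d)) * q powi (r * (r + int d))"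
      unfolding e[symmetric] add by (simp only: mult.assoc)
    finally show ?thesis ..
  qed
  thus ?thesis using 2[of L] by simp
qed

text \<open>
  Let \<open>L \<longlonglongrightarrow> \<infinity>\<close> in the finite identity. The two sides acquire the factors \<open>1 / (q;q)\<^sub>\<infinity>\<close> and \<open>1 / (q;q)\<^sub>\<infinity>\<^sup>2\<close>
  respectively, and the triple product in base \<open>q\<^sup>5\<close> evaluates the theta series.
\<close>
lemma rogers_ramanujan_theta:
  assumes q: "norm q < 1" "q \<noteq> 0" and d: "d \<le> 1"
  shows "((\<lambda>n. q ^ (n * n + d * n) / qpoch q q n) has_sum
           (qpoch_inf (q ^ 5) (q ^ 5) * qpoch_inf (q ^ (2 + 2 * d)) (q ^ 5) * qpoch_inf (q ^ (3 - 2 * d)) (q ^ 5)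
             / qpoch_inf q q)) UNIV"
proof -
  obtain C where C: "C > 0" "\<And>n. norm (qfac_recip q n) \<le> C"
    using qfac_recip_bounded[OF q(1)] by blast
  define c where "c = 1 / qpoch_inf q q"
  have c: "c \<noteq> 0" using qpoch_inf_nonzero[OF q(1) q(1)] by (simp add: c_def)
  have q5: "norm (q ^ 5) < 1" "q ^ 5 \<noteq> 0" using q by (simp_all add: norm_power power_less_one_iff)
  define z where "z = - (q ^ (2 + 2 * d))"
  have z: "z \<noteq> 0" using q by (simp add: z_def)
  define B where "B L = (\<Sum>n\<le>L. q ^ (n * n + d * n) * qfac_recip q (int L - int n) * qfac_recip q (int n))" for L
  define T where "T = qpoch_inf (q ^ 5) (q ^ 5) * qpoch_inf (- z) (q ^ 5) * qpoch_inf (- (q ^ 5) / z) (q ^ 5)"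
  have "B \<longlonglongrightarrow> infsum (\<lambda>r. (q ^ 5) powi tri r * z powi r) UNIV * (c * c)"
  proof (rule tannery_int)
    show "(\<lambda>r. norm ((q ^ 5) powi tri r * z powi r)) summable_on UNIV"
      by (rule theta_abs_summable[OF q5])
    show "((\<lambda>r. (q ^ 5) powi tri r * z powi r * (qfac_recip q (int L - r) * qfac_recip q (int L + r + int d)))
            has_sum B L) UNIV" for L
      unfolding B_def z_def by (rule rogers_ramanujan_finite[OF q d])
    show "norm (qfac_recip q (int L - r) * qfac_recip q (int L + r + int d)) \<le> C * C" for L r
      unfolding norm_mult by (intro mult_mono C) (use C in auto)
    show "(\<lambda>L. qfac_recip q (int L - r) * qfac_recip q (int L + r + int d)) \<longlonglongrightarrow> c * c" for r
      using tendsto_mult[OF qfac_recip_tendsto[OF q(1), of "- r"] qfac_recip_tendsto[OF q(1), of "r + int d"]]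
      by (simp add: c_def add.assoc)
  qed
  also have "infsum (\<lambda>r. (q ^ 5) powi tri r * z powi r) UNIV = T"
    unfolding T_def by (intro infsumI jacobi_triple_product q5 z)
  finally have lim: "B \<longlonglongrightarrow> T * c * c" by (simp add: mult.assoc)
  have "((\<lambda>n. q powi (n * (n + int d)) * qfac_recip q n) has_sum T * c) UNIV"
  proof (rule has_sum_tannery_int[OF _ _ _ _ lim c])
    \<comment> \<open>summability follows by comparison with a theta series in base \<open>q\<^sup>2\<close>\<close>
    have e: "q powi (n * (n + int d)) = (q ^ 2) powi tri n * (q ^ (1 + d)) powi n" for n
    proof -
      have "n * (n + int d) = 2 * tri n + (1 + int d) * n"
        using two_tri[of n] by (simp add: algebra_simps)
      moreover have "(q ^ (1 + d)) powi n = q powi ((1 + int d) * n)"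
        by (subst power_int_power) simp
      ultimately show ?thesis using q by (simp add: power_int_power power_int_add)
    qed
    show "(\<lambda>n. norm (q powi (n * (n + int d)) * qfac_recip q n)) summable_on UNIV"
      unfolding e using q norm_power2_less_1[OF q(1)]
      by (intro abs_summable_bounded_mult[where C = C] theta_abs_summable C) auto
    show "norm (qfac_recip q (int L - n)) \<le> C" for L n by (rule C)
    show "(\<lambda>L. qfac_recip q (int L - n)) \<longlonglongrightarrow> c" for n
      using qfac_recip_tendsto[OF q(1), of "- n"] by (simp add: c_def)
    show "((\<lambda>n. q powi (n * (n + int d)) * qfac_recip q n * qfac_recip q (int L - n)) has_sum B L) UNIV" for L
    proof (rule has_sum_finite_neutralI)
      show "B L = (\<Sum>n\<in>int ` {..L}. q powi (n * (n + int d)) * qfac_recip q n * qfac_recip q (int L - n))"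
      proof -
        have "q powi (int n * (int n + int d)) = q ^ (n * n + d * n)" for n
          by (simp add: algebra_simps flip: power_int_of_nat)
        thus ?thesis unfolding B_def by (subst sum.reindex) (auto simp: o_def mult_ac intro!: sum.cong)
      qed
      show "q powi (n * (n + int d)) * qfac_recip q n * qfac_recip q (int L - n) = 0" if "n \<in> UNIV - int ` {..L}" for n
      proof -
        have "n < 0 \<or> n > int L"
        proof (rule ccontr)
          assume "\<not> (n < 0 \<or> n > int L)"
          hence "n = int (nat n)" "nat n \<le> L" by auto
          thus False using that by (metis DiffD2 atMost_iff imageI)
        qed
        thus ?thesis by auto
      qed
    qed auto
  qed
  from has_sum_int_imp_nat[OF this]
  have "((\<lambda>n. q powi (int n * (int n + int d)) * qfac_recip q (int n)) has_sum T * c) UNIV" by simp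
  moreover have "q powi (int n * (int n + int d)) = q ^ (n * n + d * n)" for n
    by (simp add: algebra_simps flip: power_int_of_nat)
  moreover have "- (q ^ 5) / z = q ^ (3 - 2 * d)"
  proof -
    have "q ^ 5 = q ^ (3 - 2 * d) * q ^ (2 + 2 * d)"
      using d by (cases d) (auto simp: eval_nat_numeral)
    thus ?thesis using q by (simp add: z_def)
  qed
  ultimately show ?thesis by (simp add: T_def c_def z_def)
qed

lemma qpoch_dissect_5:
  "qpoch q q (5 * N) = qpoch q (q ^ 5) N * qpoch (q ^ 2) (q ^ 5) N * qpoch (q ^ 3) (q ^ 5) N *
     qpoch (q ^ 4) (q ^ 5) N * qpoch (q ^ 5) (q ^ 5) N"
proof (induction N)
  case (Suc N)
  define X where "X = (q ^ 5) ^ N"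
  have X: "q ^ (5 * N) = X" unfolding X_def by (rule power_mult)
  have "5 * Suc N = Suc (Suc (Suc (Suc (Suc (5 * N)))))" by simp
  hence "qpoch q q (5 * Suc N) = qpoch q q (5 * N) * (1 - q * X) * (1 - q ^ 2 * X) *
     (1 - q ^ 3 * X) * (1 - q ^ 4 * X) * (1 - q ^ 5 * X)"
    by (simp only: qpoch_Suc power_Suc X) (simp add: eval_nat_numeral mult_ac)
  thus ?case unfolding Suc.IH qpoch_Suc X_def by (simp only: mult_ac)
qed simp

lemma qpoch_inf_dissect_5:
  assumes "norm q < 1"
  shows "qpoch_inf q q = qpoch_inf q (q ^ 5) * qpoch_inf (q ^ 2) (q ^ 5) * qpoch_inf (q ^ 3) (q ^ 5) *
     qpoch_inf (q ^ 4) (q ^ 5) * qpoch_inf (q ^ 5) (q ^ 5)"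
proof (rule LIMSEQ_unique)
  have q5: "norm (q ^ 5) < 1" using assms by (simp add: norm_power power_less_one_iff)
  have "strict_mono (\<lambda>n. 5 * n :: nat)" by (auto simp: strict_mono_def)
  from LIMSEQ_subseq_LIMSEQ[OF qpoch_tendsto[OF assms, of q] this]
  show "(\<lambda>N. qpoch q q (5 * N)) \<longlonglongrightarrow> qpoch_inf q q" by (simp add: o_def)
  show "(\<lambda>N. qpoch q q (5 * N)) \<longlonglongrightarrow> qpoch_inf q (q ^ 5) * qpoch_inf (q ^ 2) (q ^ 5) * qpoch_inf (q ^ 3) (q ^ 5) *
     qpoch_inf (q ^ 4) (q ^ 5) * qpoch_inf (q ^ 5) (q ^ 5)"
    unfolding qpoch_dissect_5 by (intro tendsto_mult qpoch_tendsto q5)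
qed

text \<open>
  For \<open>d = 0\<close> and \<open>d = 1\<close> the theta product contains the residue classes \<open>{0, 2, 3}\<close> and \<open>{0, 1, 4}\<close>
  modulo \<open>5\<close>, which cancel against \<open>(q;q)\<^sub>\<infinity>\<close> and leave the complementary classes in the denominator.
\<close>
lemma rogers_ramanujan:
  assumes q: "norm q < 1" "q \<noteq> 0"
  shows "((\<lambda>n. q ^ (n * n) / qpoch q q n) has_sum 1 / (qpoch_inf q (q ^ 5) * qpoch_inf (q ^ 4) (q ^ 5))) UNIV"
    and "((\<lambda>n. q ^ (n * n + n) / qpoch q q n) has_sum 1 / (qpoch_inf (q ^ 2) (q ^ 5) * qpoch_inf (q ^ 3) (q ^ 5))) UNIV"
proof -
  have nz: "qpoch_inf (q ^ i) (q ^ 5) \<noteq> 0" if "i > 0" for i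
    by (rule qpoch_inf_nonzero) (use q that in \<open>simp_all add: norm_power power_less_one_iff\<close>)
  note nzs = nz[of 1, simplified] nz[of 2, simplified] nz[of 3, simplified] nz[of 4, simplified] nz[of 5, simplified]
  have cancel: "E * B * C / (A * B * C * D * E) = 1 / (A * D)" "E * D * A / (A * B * C * D * E) = 1 / (B * C)"
    if "A \<noteq> 0" "B \<noteq> 0" "C \<noteq> 0" "D \<noteq> 0" "E \<noteq> 0" for A B C D E :: complex
    using that by (simp_all add: field_simps)
  note cancel = cancel[OF nzs, folded qpoch_inf_dissect_5[OF q(1)]]
  show "((\<lambda>n. q ^ (n * n) / qpoch q q n) has_sum 1 / (qpoch_inf q (q ^ 5) * qpoch_inf (q ^ 4) (q ^ 5))) UNIV"
    using rogers_ramanujan_theta[OF q, of 0] unfolding cancel(1)[symmetric] by simp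
  show "((\<lambda>n. q ^ (n * n + n) / qpoch q q n) has_sum 1 / (qpoch_inf (q ^ 2) (q ^ 5) * qpoch_inf (q ^ 3) (q ^ 5))) UNIV"
    using rogers_ramanujan_theta[OF q, of 1] unfolding cancel(2)[symmetric] by simp
qed

section \<open>Reduction of the triple sums\<close>

lemma qpoch_inf_split:
  assumes "norm q < 1"
  shows "qpoch_inf a q = qpoch a q j * qpoch_inf (a * q ^ j) q"
proof (rule LIMSEQ_unique)
  show "(\<lambda>n. qpoch a q (n + j)) \<longlonglongrightarrow> qpoch_inf a q"
    by (rule LIMSEQ_ignore_initial_segment[OF qpoch_tendsto[OF assms]])
  have "qpoch a q (n + j) = qpoch a q j * qpoch (a * q ^ j) q n" for n
    by (induction n) (simp_all add: qpoch_Suc power_add mult_ac)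
  thus "(\<lambda>n. qpoch a q (n + j)) \<longlonglongrightarrow> qpoch a q j * qpoch_inf (a * q ^ j) q"
    by (simp only:) (intro tendsto_mult tendsto_const qpoch_tendsto assms)
qed

lemma qpoch_square_base: "qpoch (q ^ 2) (q ^ 2) n = qpoch q q n * qpoch (- q) q n"
proof (induction n)
  case (Suc n)
  have "1 - q ^ 2 * (q ^ 2) ^ n = (1 - q * q ^ n) * (1 - - q * q ^ n)"
    by (simp add: algebra_simps power2_eq_square power_mult_distrib)
  thus ?case unfolding qpoch_Suc Suc.IH by (simp only: mult_ac)
qed simp

lemma geometric_has_sum:
  fixes x :: real
  assumes "0 \<le> x" "x < 1"
  shows "((\<lambda>n. x ^ n) has_sum (1 / (1 - x))) UNIV"
  using assms by (intro norm_summable_imp_has_sum) (auto intro!: geometric_sums simp: norm_power)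

lemma geometric_times_summable:
  fixes x :: real and h :: "'a \<Rightarrow> real"
  assumes x: "0 \<le> x" "x < 1" and h: "h summable_on UNIV" "\<And>y. h y \<ge> 0"
  shows "(\<lambda>(i, y). x ^ i * h y) summable_on (UNIV :: (nat \<times> 'a) set)"
proof -
  have "(\<lambda>(i, y). x ^ i * h y) summable_on Sigma (UNIV :: nat set) (\<lambda>_. UNIV)"
  proof (rule summable_on_SigmaI)
    show "((\<lambda>y. case (i, y) of (i, y) \<Rightarrow> x ^ i * h y) has_sum (x ^ i * infsum h UNIV)) UNIV" for i
      using has_sum_cmult_right[OF has_sum_infsum[OF h(1)]] by simp
    show "(\<lambda>i. x ^ i * infsum h UNIV) summable_on UNIV"
      using has_sum_cmult_left[OF geometric_has_sum[OF x]] by (auto simp: summable_on_def)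
  qed (use x h in auto)
  thus ?thesis by simp
qed

lemma geometric_triple_summable:
  fixes x :: real
  assumes "0 \<le> x" "x < 1"
  shows "(\<lambda>(i, j, k). x ^ (i + j + k)) summable_on (UNIV :: (nat \<times> nat \<times> nat) set)"
proof -
  have "(\<lambda>k. x ^ k) summable_on UNIV"
    using geometric_has_sum[OF assms] by (auto simp: summable_on_def)
  from geometric_times_summable[OF assms geometric_times_summable[OF assms this]] show ?thesis
    using assms by (simp add: case_prod_unfold power_add mult_ac)
qed

text \<open>
  The exponents of the four identities, as a function of the coefficients \<open>b\<close> and \<open>c\<close> of \<open>j\<close> and \<open>k\<close> in
  the linear part; \<open>double_exponent\<close> below is what remains after the sum over \<open>i\<close>.
\<close>
definition triple_exponent :: "int \<Rightarrow> int \<Rightarrow> nat \<Rightarrow> nat \<Rightarrow> nat \<Rightarrow> int" where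
  "triple_exponent b c i j k = (int i ^ 2 + 3 * int j ^ 2 + 3 * int k ^ 2 + 2 * int i * int j + 2 * int j * int k
                 + int i + b * int j + c * int k) div 2"

definition double_exponent :: "int \<Rightarrow> int \<Rightarrow> nat \<Rightarrow> nat \<Rightarrow> int" where
  "double_exponent b c j k = (3 * int j ^ 2 + 3 * int k ^ 2 + 2 * int j * int k + b * int j + c * int k) div 2"

lemma triple_exponent_eq:
  "triple_exponent b c i j k = tri (int i) + int i * (int j + 1) + double_exponent b c j k"
proof -
  have "int i ^ 2 + 3 * int j ^ 2 + 3 * int k ^ 2 + 2 * int i * int j + 2 * int j * int k + int i + b * int j + c * int k =
    2 * (tri (int i) + int i * (int j + 1)) + (3 * int j ^ 2 + 3 * int k ^ 2 + 2 * int j * int k + b * int j + c * int k)"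
    using two_tri[of "int i"] by (simp add: algebra_simps power2_eq_square)
  thus ?thesis unfolding triple_exponent_def double_exponent_def by simp
qed

text \<open>
  This linear bound gives both the absolute convergence of the triple sum, by comparison with a geometric one, and
  the vanishing of all terms but the first at \<open>q = 0\<close>.
\<close>
lemma triple_exponent_ge:
  assumes "b \<ge> -1" "c \<ge> -1"
  shows "int (i + j + k) \<le> triple_exponent b c i j k"
proof -
  have sq: "int n \<le> int n ^ 2" for n
    by (cases n) (auto simp: power2_eq_square)
  have lin: "- int n \<le> x * int n" if "x \<ge> -1" for x n
    using mult_right_mono[OF that, of "int n"] by simp
  have i: "2 * int i \<le> int i ^ 2 + int i" using sq[of i] by linarith
  have j: "2 * int j \<le> 3 * int j ^ 2 + b * int j" using sq[of j] lin[OF assms(1), of j] by linarith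
  have k: "2 * int k \<le> 3 * int k ^ 2 + c * int k" using sq[of k] lin[OF assms(2), of k] by linarith
  have "0 \<le> 2 * int i * int j" "0 \<le> 2 * int j * int k" by simp_all
  with i j k have "2 * int i + 2 * int j + 2 * int k \<le> int i ^ 2 + 3 * int j ^ 2 + 3 * int k ^ 2
                 + 2 * int i * int j + 2 * int j * int k + int i + b * int j + c * int k"
    by linarith
  thus ?thesis unfolding triple_exponent_def of_nat_add by linarith
qed

lemma triple_summable:
  assumes q: "norm q < 1" and bc: "b \<ge> -1" "c \<ge> -1"
  shows "(\<lambda>(i, j, k). q powi triple_exponent b c i j k / (qpoch q q i * qpoch q q j * qpoch (q ^ 2) (q ^ 2) k))
           summable_on UNIV"
proof -
  obtain C1 where C1: "C1 > 0" "\<And>n. norm (qfac_recip q n) \<le> C1"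
    using qfac_recip_bounded[OF q] by blast
  obtain C2 where C2: "C2 > 0" "\<And>n. norm (qfac_recip (q ^ 2) n) \<le> C2"
    using qfac_recip_bounded[OF norm_power2_less_1[OF q]] by blast
  show ?thesis
  proof (rule abs_summable_summable, rule Infinite_Sum.abs_summable_on_comparison_test')
    show "(\<lambda>x. (case x of (i, j, k) \<Rightarrow> norm q ^ (i + j + k)) * (C1 * C1 * C2)) summable_on UNIV"
      by (intro summable_on_cmult_left geometric_triple_summable) (use q in auto)
    show "norm (case x of (i, j, k) \<Rightarrow> q powi triple_exponent b c i j k / (qpoch q q i * qpoch q q j * qpoch (q ^ 2) (q ^ 2) k))
            \<le> (case x of (i, j, k) \<Rightarrow> norm q ^ (i + j + k)) * (C1 * C1 * C2)" for x
    proof (cases x)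
      case (fields i j k)
      define e where "e = nat (triple_exponent b c i j k)"
      have e: "triple_exponent b c i j k = int e" "i + j + k \<le> e"
        using triple_exponent_ge[OF bc, of i j k] by (auto simp: e_def)
      have "norm (q powi triple_exponent b c i j k) = norm q ^ e" by (simp add: e norm_power)
      also have "\<dots> \<le> norm q ^ (i + j + k)" by (rule power_decreasing) (use q e in auto)
      finally have 1: "norm (q powi triple_exponent b c i j k) \<le> norm q ^ (i + j + k)" .
      have "norm (q powi triple_exponent b c i j k * (qfac_recip q (int i) * qfac_recip q (int j) * qfac_recip (q ^ 2) (int k)))
         \<le> norm q ^ (i + j + k) * (C1 * C1 * C2)"
        unfolding norm_mult by (intro mult_mono 1 C1 C2) (use C1(1) C2(1) in auto)
      thus ?thesis by (simp add: fields)
    qed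
  qed
qed

text \<open>
  Absolute convergence allows the sum over \<open>i\<close> to be carried out first, by Euler's identity with \<open>z = q\<^bsup>j+1\<^esup>\<close>.
  The common value \<open>T\<close> is left unspecified here: its existence comes from the triple sum, and the double sum
  determines it.
\<close>
lemma triple_to_double_sum:
  assumes q: "norm q < 1" "q \<noteq> 0" and bc: "b \<ge> -1" "c \<ge> -1"
  obtains T where
    "((\<lambda>(i, j, k). q powi triple_exponent b c i j k / (qpoch q q i * qpoch q q j * qpoch (q ^ 2) (q ^ 2) k))
        has_sum (qpoch_inf (- q) q * T)) UNIV"
    "((\<lambda>(j, k). q powi double_exponent b c j k / (qpoch (q ^ 2) (q ^ 2) j * qpoch (q ^ 2) (q ^ 2) k)) has_sum T) UNIV"
proof -
  define f where "f = (\<lambda>(i, j, k). q powi triple_exponent b c i j k / (qpoch q q i * qpoch q q j * qpoch (q ^ 2) (q ^ 2) k))"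
  define g where "g = (\<lambda>(j, k). q powi double_exponent b c j k / (qpoch (q ^ 2) (q ^ 2) j * qpoch (q ^ 2) (q ^ 2) k))"
  have nz: "qpoch_inf (- q) q \<noteq> 0" by (rule qpoch_inf_nonzero) (use q in auto)
  define S where "S = infsum f UNIV"
  have f: "(f has_sum S) UNIV"
    unfolding S_def f_def by (intro has_sum_infsum triple_summable q bc)
  hence "(f has_sum S) (UNIV \<times> UNIV)" by simp
  hence swapped: "((\<lambda>(y, i). f (i, y)) has_sum S) (UNIV \<times> UNIV)"
    by (rule has_sum_swap[THEN iffD1])
  have inner: "((\<lambda>i. (case (y, i) of (y, i) \<Rightarrow> f (i, y))) has_sum (qpoch_inf (- q) q * g y)) UNIV" for y
  proof (cases y)
    case (Pair j k)
    define A where "A = q powi double_exponent b c j k / (qpoch q q j * qpoch (q ^ 2) (q ^ 2) k)"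
    have "((\<lambda>i. A * (q powi tri (int i) * (q ^ (j + 1)) ^ i / qpoch q q i)) has_sum A * qpoch_inf (- (q ^ (j + 1))) q) UNIV"
      by (intro has_sum_cmult_right euler_sum) (use q in auto)
    moreover have "A * (q powi tri (int i) * (q ^ (j + 1)) ^ i / qpoch q q i) = f (i, y)" for i
    proof -
      have "(q ^ (j + 1)) ^ i = q powi (int i * (int j + 1))"
      proof -
        have "q powi int ((j + 1) * i) = (q ^ (j + 1)) ^ i" by (simp only: power_int_of_nat power_mult)
        moreover have "int ((j + 1) * i) = int i * (int j + 1)" by (simp add: algebra_simps)
        ultimately show ?thesis by simp
      qed
      thus ?thesis using q by (simp add: A_def f_def Pair triple_exponent_eq power_int_add mult_ac)
    qed
    moreover have "A * qpoch_inf (- (q ^ (j + 1))) q = qpoch_inf (- q) q * g y"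
    proof -
      have "qpoch (q ^ 2) (q ^ 2) j \<noteq> 0"
        by (rule qpoch_self_nonzero[OF norm_power2_less_1[OF q(1)]])
      hence "qpoch (- q) q j \<noteq> 0" "qpoch q q j \<noteq> 0" by (auto simp: qpoch_square_base)
      thus ?thesis unfolding A_def g_def Pair qpoch_inf_split[OF q(1), of "- q" j]
        by (simp add: qpoch_square_base[of q j])
    qed
    ultimately show ?thesis by simp
  qed
  have "((\<lambda>y. qpoch_inf (- q) q * g y) has_sum S) UNIV"
    by (rule has_sum_SigmaD[OF swapped inner])
  from has_sum_cmult_right[OF this, of "inverse (qpoch_inf (- q) q)"]
  have "(g has_sum (S / qpoch_inf (- q) q)) UNIV"
    using nz by (simp add: field_simps)
  moreover have "(f has_sum (qpoch_inf (- q) q * (S / qpoch_inf (- q) q))) UNIV"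
    using f nz by simp
  ultimately show ?thesis using that unfolding f_def g_def by blast
qed

lemma antidiagonal_sum:
  assumes q: "norm q < 1" "q \<noteq> 0"
  shows "(\<Sum>j\<le>n. q powi tri (2 * int j - int n) / (qpoch (q ^ 2) (q ^ 2) j * qpoch (q ^ 2) (q ^ 2) (n - j)))
           = 1 / qpoch q q n"
proof (rule has_sum_unique)
  show "((\<lambda>j. q powi tri (2 * int j - int n) * qfac_recip (q ^ 2) (int j) * qfac_recip (q ^ 2) (int n - int j))
          has_sum (1 / qpoch q q n)) UNIV"
    by (rule has_sum_int_imp_nat[OF antidiagonal_sum_int[OF q]]) simp
  show "((\<lambda>j. q powi tri (2 * int j - int n) * qfac_recip (q ^ 2) (int j) * qfac_recip (q ^ 2) (int n - int j))
          has_sum (\<Sum>j\<le>n. q powi tri (2 * int j - int n) / (qpoch (q ^ 2) (q ^ 2) j * qpoch (q ^ 2) (q ^ 2) (n - j)))) UNIV"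
    by (rule has_sum_finite_neutralI[of "{..n}"]) (auto simp flip: of_nat_diff intro!: sum.cong)
qed

lemma double_exponent_eq:
  assumes "j \<le> n"
  shows "double_exponent (2 * int d - 1) (2 * int d + 1) j (n - j) = int (n * n + d * n) + tri (2 * int j - int n)"
proof -
  have k: "int (n - j) = int n - int j" using assms by simp
  have "3 * int j ^ 2 + 3 * int (n - j) ^ 2 + 2 * int j * int (n - j) + (2 * int d - 1) * int j + (2 * int d + 1) * int (n - j)
     = 2 * (int (n * n + d * n)) + 2 * tri (2 * int j - int n)"
    unfolding two_tri k by (simp add: algebra_simps power2_eq_square)
  thus ?thesis unfolding double_exponent_def by simp
qed

text \<open>
  Grouping by \<open>n = j + k\<close> is the bijection \<open>(n, j) \<mapsto> (j, n - j)\<close> from \<open>{(n, j). j \<le> n}\<close>, and each group is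
  evaluated by the antidiagonal sum.
\<close>
lemma double_sum_antidiagonals:
  assumes q: "norm q < 1" "q \<noteq> 0"
    and T: "((\<lambda>(j, k). q powi double_exponent (2 * int d - 1) (2 * int d + 1) j k /
               (qpoch (q ^ 2) (q ^ 2) j * qpoch (q ^ 2) (q ^ 2) k)) has_sum T) UNIV"
  shows "((\<lambda>n. q ^ (n * n + d * n) / qpoch q q n) has_sum T) UNIV"
proof -
  define h where "h = (\<lambda>(j, k). q powi double_exponent (2 * int d - 1) (2 * int d + 1) j k /
               (qpoch (q ^ 2) (q ^ 2) j * qpoch (q ^ 2) (q ^ 2) k))"
  have "((\<lambda>(n, j). h (j, n - j)) has_sum T) (Sigma UNIV (\<lambda>n. {..n})) \<longleftrightarrow> (h has_sum T) UNIV"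
    by (rule has_sum_reindex_bij_witness[where i = "\<lambda>(j, k). (j + k, j)" and j = "\<lambda>(n, j). (j, n - j)"]) auto
  hence "((\<lambda>(n, j). h (j, n - j)) has_sum T) (Sigma UNIV (\<lambda>n. {..n}))"
    using T by (simp add: h_def)
  thus ?thesis
  proof (rule has_sum_SigmaD)
    fix n :: nat
    show "((\<lambda>j. case (n, j) of (n, j) \<Rightarrow> h (j, n - j)) has_sum q ^ (n * n + d * n) / qpoch q q n) {..n}"
    proof (rule has_sum_finiteI)
      have "q ^ (n * n + d * n) / qpoch q q n = (\<Sum>j\<le>n. q ^ (n * n + d * n) *
        (q powi tri (2 * int j - int n) / (qpoch (q ^ 2) (q ^ 2) j * qpoch (q ^ 2) (q ^ 2) (n - j))))"
        unfolding sum_distrib_left[symmetric] antidiagonal_sum[OF q] by simp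
      also have "\<dots> = (\<Sum>j\<le>n. h (j, n - j))"
      proof (rule sum.cong)
        show "q ^ (n * n + d * n) * (q powi tri (2 * int j - int n) / (qpoch (q ^ 2) (q ^ 2) j * qpoch (q ^ 2) (q ^ 2) (n - j)))
          = h (j, n - j)" if "j \<in> {..n}" for j
        proof -
          have "q powi (int (n * n + d * n) + tri (2 * int j - int n)) = q ^ (n * n + d * n) * q powi tri (2 * int j - int n)"
            by (subst power_int_add) (use q in \<open>simp_all del: of_nat_add of_nat_mult\<close>)
          thus ?thesis using that by (simp add: h_def double_exponent_eq)
        qed
      qed simp
      finally show "q ^ (n * n + d * n) / qpoch q q n = (\<Sum>j\<le>n. case (n, j) of (n, j) \<Rightarrow> h (j, n - j))" by simp
    qed simp
  qed
qed

lemma double_exponent_swap: "double_exponent b c j k = double_exponent c b k j"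
  unfolding double_exponent_def by (simp add: algebra_simps)

text \<open>
  The two admissible pairs \<open>(b, c)\<close> are exchanged by the symmetry of the double sum in \<open>j\<close> and \<open>k\<close>, so both lead
  to the same sum over \<open>n\<close>.
\<close>
lemma triple_sum_from_rogers_ramanujan:
  assumes q: "norm q < 1" "q \<noteq> 0"
    and S: "((\<lambda>n. q ^ (n * n + d * n) / qpoch q q n) has_sum S) UNIV"
    and bc: "(b, c) = (2 * int d - 1, 2 * int d + 1) \<or> (b, c) = (2 * int d + 1, 2 * int d - 1)"
  shows "((\<lambda>(i, j, k). q powi triple_exponent b c i j k / (qpoch q q i * qpoch q q j * qpoch (q ^ 2) (q ^ 2) k))
        has_sum (qpoch_inf (- q) q * S)) UNIV"
proof -
  have "b \<ge> -1" "c \<ge> -1" using bc by auto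
  from triple_to_double_sum[OF q this] obtain T where T:
    "((\<lambda>(i, j, k). q powi triple_exponent b c i j k / (qpoch q q i * qpoch q q j * qpoch (q ^ 2) (q ^ 2) k))
        has_sum (qpoch_inf (- q) q * T)) UNIV"
    "((\<lambda>(j, k). q powi double_exponent b c j k / (qpoch (q ^ 2) (q ^ 2) j * qpoch (q ^ 2) (q ^ 2) k)) has_sum T) UNIV"
    by blast
  from T(2) have "((\<lambda>(j, k). q powi double_exponent b c j k / (qpoch (q ^ 2) (q ^ 2) j * qpoch (q ^ 2) (q ^ 2) k)) has_sum T) (UNIV \<times> UNIV)"
    by simp
  from has_sum_swap[THEN iffD1, OF this]
  have "((\<lambda>(j, k). q powi double_exponent c b j k / (qpoch (q ^ 2) (q ^ 2) j * qpoch (q ^ 2) (q ^ 2) k)) has_sum T) UNIV"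
    by (simp add: double_exponent_swap[of b c] mult.commute case_prod_unfold)
  with T(2) bc have "((\<lambda>n. q ^ (n * n + d * n) / qpoch q q n) has_sum T) UNIV"
    by (auto intro: double_sum_antidiagonals[OF q])
  hence "T = S" using S by (rule has_sum_unique)
  thus ?thesis using T(1) by simp
qed

lemma qpoch_inf_0 [simp]: "qpoch_inf 0 q = 1"
  by (simp add: qpoch_inf_def)

text \<open>
  The reduction above uses negative powers of \<open>q\<close>, so \<open>q = 0\<close> is treated directly.
\<close>
lemma triple_sum_zero_base:
  assumes bc: "b \<ge> -1" "c \<ge> -1"
  shows "((\<lambda>(i, j, k). 0 powi triple_exponent b c i j k / (qpoch 0 0 i * qpoch 0 0 j * qpoch (0 ^ 2) (0 ^ 2) k))
        has_sum 1) UNIV"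
proof (rule has_sum_finite_neutralI[of "{(0, 0, 0)}"])
  show "(case x of (i, j, k) \<Rightarrow> 0 powi triple_exponent b c i j k / (qpoch 0 0 i * qpoch 0 0 j * qpoch (0 ^ 2) (0 ^ 2) k)) = 0"
    if "x \<in> UNIV - {(0, 0, 0)}" for x
  proof (cases x)
    case (fields i j k)
    have "triple_exponent b c i j k \<noteq> 0"
      using triple_exponent_ge[OF bc, of i j k] that fields by auto
    thus ?thesis by (simp add: fields)
  qed
qed (auto simp: triple_exponent_def)

theorem theorem3p19:
  fixes q :: complex
  assumes "norm q < 1"
  shows
    "((\<lambda>(i, j, k).
        q powi ((int i ^ 2 + 3 * int j ^ 2 + 3 * int k ^ 2 + 2 * int i * int j + 2 * int j * int k
                 + int i - int j + int k) div 2)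
        / (qpoch q q i * qpoch q q j * qpoch (q ^ 2) (q ^ 2) k))
      has_sum (qpoch_inf (- q) q / (qpoch_inf q (q ^ 5) * qpoch_inf (q ^ 4) (q ^ 5)))) UNIV
     \<and>
     ((\<lambda>(i, j, k).
        q powi ((int i ^ 2 + 3 * int j ^ 2 + 3 * int k ^ 2 + 2 * int i * int j + 2 * int j * int k
                 + int i + int j - int k) div 2)
        / (qpoch q q i * qpoch q q j * qpoch (q ^ 2) (q ^ 2) k))
      has_sum (qpoch_inf (- q) q / (qpoch_inf q (q ^ 5) * qpoch_inf (q ^ 4) (q ^ 5)))) UNIV
     \<and>
     ((\<lambda>(i, j, k).
        q powi ((int i ^ 2 + 3 * int j ^ 2 + 3 * int k ^ 2 + 2 * int i * int j + 2 * int j * int k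
                 + int i + int j + 3 * int k) div 2)
        / (qpoch q q i * qpoch q q j * qpoch (q ^ 2) (q ^ 2) k))
      has_sum (qpoch_inf (- q) q / (qpoch_inf (q ^ 2) (q ^ 5) * qpoch_inf (q ^ 3) (q ^ 5)))) UNIV
     \<and>
     ((\<lambda>(i, j, k).
        q powi ((int i ^ 2 + 3 * int j ^ 2 + 3 * int k ^ 2 + 2 * int i * int j + 2 * int j * int k
                 + int i + 3 * int j + int k) div 2)
        / (qpoch q q i * qpoch q q j * qpoch (q ^ 2) (q ^ 2) k))
      has_sum (qpoch_inf (- q) q / (qpoch_inf (q ^ 2) (q ^ 5) * qpoch_inf (q ^ 3) (q ^ 5)))) UNIV"
proof -
  let ?G = "qpoch_inf (- q) q / (qpoch_inf q (q ^ 5) * qpoch_inf (q ^ 4) (q ^ 5))"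
  let ?H = "qpoch_inf (- q) q / (qpoch_inf (q ^ 2) (q ^ 5) * qpoch_inf (q ^ 3) (q ^ 5))"
  let ?P = "\<lambda>b c X. ((\<lambda>(i, j, k). q powi triple_exponent b c i j k /
        (qpoch q q i * qpoch q q j * qpoch (q ^ 2) (q ^ 2) k)) has_sum X) UNIV"
  have "?P (-1) 1 ?G \<and> ?P 1 (-1) ?G \<and> ?P 1 3 ?H \<and> ?P 3 1 ?H"
  proof (cases "q = 0")
    case True
    thus ?thesis using triple_sum_zero_base by simp
  next
    case False
    note q = assms False
    have G: "((\<lambda>n. q ^ (n * n + 0 * n) / qpoch q q n) has_sum 1 / (qpoch_inf q (q ^ 5) * qpoch_inf (q ^ 4) (q ^ 5))) UNIV"
      using rogers_ramanujan(1)[OF q] by simp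
    have H: "((\<lambda>n. q ^ (n * n + 1 * n) / qpoch q q n) has_sum 1 / (qpoch_inf (q ^ 2) (q ^ 5) * qpoch_inf (q ^ 3) (q ^ 5))) UNIV"
      using rogers_ramanujan(2)[OF q] by simp
    show ?thesis
      using triple_sum_from_rogers_ramanujan[OF q G, of "-1" 1] triple_sum_from_rogers_ramanujan[OF q G, of 1 "-1"]
            triple_sum_from_rogers_ramanujan[OF q H, of 1 3] triple_sum_from_rogers_ramanujan[OF q H, of 3 1] by simp
  qed
  thus ?thesis by (simp add: triple_exponent_def)
qed

end
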